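(* For every $\bar u\in L^1(\Omega)$, \[ \widehat{\partial} q_{1,0}(\bar u)=\begin{cases}\{0\} & \text{if } \bar u=0 \text{ a.e. on } \Omega,\\ \varnothing & \text{otherwise.}\end{cases} \]
   Context: $\Omega\subset\mathbb{R}^d$ is a Lebesgue-measurable set with positive and finite Lebesgue measure; $\boldsymbol{\lambda}$ denotes Lebesgue measure. $L^1(\Omega)$ is the usual real Lebesgue space with norm $\Vert\cdot\Vert_1$, and its dual is identified with $L^\infty(\Omega)$. The functional $q_{1,0}\colon L^1(\Omega)\to\mathbb{R}$ is $q_{1,0}(u):=\int_\Omega |u(x)|_0\,\mathrm{d}x=\boldsymbol{\lambda}(\{x\in\Omega : u(x)\neq 0\})$, where $|y|_0:=0$ if $y=0$ and $|y|_0:=1$ for $y\in\mathbb{R}\setminus\{0\}$. The Fréchet subdifferential of $q_{1,0}$ at $\bar u\in L^1(\Omega)$ is \[ \widehat{\partial} q_{1,0}(\bar u):=\Bigl\{\eta\in L^\infty(\Omega) : \liminf_{\Vert h\Vert_1\searrow 0}\frac{q_{1,0}(\bar u+h)-q_{1,0}(\bar u)-\int_\Omega\eta(x)h(x)\,\mathrm{d}x}{\Vert h\Vert_1}\ge 0\Bigr\}, \] where the lower limit is over $h\in L^1(\Omega)\setminus\{0\}$ with $\Vert h\Vert_1\to 0$. *)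

theory Defs
  imports "HOL-Analysis.Analysis"
begin

text \<open>
  Elements of \<open>L\<^sup>1(\<Omega>)\<close> and \<open>L\<^sup>\<infinity>(\<Omega>)\<close> are represented by functions on the ambient space that are
  measurable on \<open>\<Omega>\<close>; values outside \<open>\<Omega>\<close> are irrelevant. Identification of functions that agree
  almost everywhere on \<open>\<Omega>\<close> is made explicit by the equivalence relation \<open>ae_rel \<Omega>\<close>.
\<close>

definition L1 :: "'a::euclidean_space set \<Rightarrow> ('a \<Rightarrow> real) set" where
  "L1 \<Omega> = {u. integrable (lebesgue_on \<Omega>) u}"

definition norm_L1 :: "'a::euclidean_space set \<Rightarrow> ('a \<Rightarrow> real) \<Rightarrow> real" where
  "norm_L1 \<Omega> u = (\<integral>x. \<bar>u x\<bar> \<partial>lebesgue_on \<Omega>)"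

definition Linf :: "'a::euclidean_space set \<Rightarrow> ('a \<Rightarrow> real) set" where
  "Linf \<Omega> = {\<eta> \<in> borel_measurable (lebesgue_on \<Omega>). \<exists>C. AE x in lebesgue_on \<Omega>. \<bar>\<eta> x\<bar> \<le> C}"

definition ae_rel :: "'a::euclidean_space set \<Rightarrow> (('a \<Rightarrow> real) \<times> ('a \<Rightarrow> real)) set" where
  "ae_rel \<Omega> = {(f, g). f \<in> borel_measurable (lebesgue_on \<Omega>) \<and>
     g \<in> borel_measurable (lebesgue_on \<Omega>) \<and> (AE x in lebesgue_on \<Omega>. f x = g x)}"

lemma equiv_ae_rel: "equiv (borel_measurable (lebesgue_on \<Omega>)) (ae_rel \<Omega>)"
proof (rule equivI)
  show "ae_rel \<Omega> \<subseteq> borel_measurable (lebesgue_on \<Omega>) \<times> borel_measurable (lebesgue_on \<Omega>)"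
    by (auto simp: ae_rel_def)
  show "refl_on (borel_measurable (lebesgue_on \<Omega>)) (ae_rel \<Omega>)"
    by (auto simp: refl_on_def ae_rel_def)
  show "sym (ae_rel \<Omega>)"
    by (auto simp: sym_def ae_rel_def eq_commute)
  show "trans (ae_rel \<Omega>)"
  proof (rule transI)
    fix f g h assume fg: "(f, g) \<in> ae_rel \<Omega>" and gh: "(g, h) \<in> ae_rel \<Omega>"
    then have "AE x in lebesgue_on \<Omega>. f x = g x" "AE x in lebesgue_on \<Omega>. g x = h x"
      by (auto simp: ae_rel_def)
    then have "AE x in lebesgue_on \<Omega>. f x = h x"
      by eventually_elim simp
    with fg gh show "(f, h) \<in> ae_rel \<Omega>"
      by (auto simp: ae_rel_def)
  qed
qed

definition abs0 :: "real \<Rightarrow> real" where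
  "abs0 y = (if y = 0 then 0 else 1)"

definition q10 :: "'a::euclidean_space set \<Rightarrow> ('a \<Rightarrow> real) \<Rightarrow> real" where
  "q10 \<Omega> u = (\<integral>x. abs0 (u x) \<partial>lebesgue_on \<Omega>)"

lemma q10_eq_measure:
  assumes "\<Omega> \<in> sets lebesgue"
  shows "q10 \<Omega> u = measure lebesgue {x \<in> \<Omega>. u x \<noteq> 0}"
proof -
  have "q10 \<Omega> u = (\<integral>x. indicator {x. u x \<noteq> 0} x \<partial>lebesgue_on \<Omega>)"
    unfolding q10_def by (rule Bochner_Integration.integral_cong) (auto simp: abs0_def)
  also have "\<dots> = measure (lebesgue_on \<Omega>) ({x. u x \<noteq> 0} \<inter> \<Omega>)"
    by simp
  also have "\<dots> = measure lebesgue {x \<in> \<Omega>. u x \<noteq> 0}"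
    using assms by (subst measure_restrict_space) (auto intro!: arg_cong[where f = "measure lebesgue"])
  finally show ?thesis .
qed

text \<open>
  The filter describing \<open>h \<in> L\<^sup>1(\<Omega>) - {0}\<close> with \<open>norm_L1 \<Omega> h \<rightarrow> 0\<close>. Using \<open>at_right 0\<close> for the norm
  excludes exactly those \<open>h\<close> that vanish almost everywhere on \<open>\<Omega>\<close>.
\<close>

definition at_zero_L1 :: "'a::euclidean_space set \<Rightarrow> ('a \<Rightarrow> real) filter" where
  "at_zero_L1 \<Omega> = inf (filtercomap (norm_L1 \<Omega>) (at_right 0)) (principal (L1 \<Omega>))"

lemma eventually_at_zero_L1:
  "eventually P (at_zero_L1 \<Omega>) \<longleftrightarrow>
     (\<exists>\<delta>>0. \<forall>h\<in>L1 \<Omega>. 0 < norm_L1 \<Omega> h \<and> norm_L1 \<Omega> h < \<delta> \<longrightarrow> P h)"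
proof
  assume "eventually P (at_zero_L1 \<Omega>)"
  then obtain Q \<delta> where Q: "\<And>h. Q (norm_L1 \<Omega> h) \<Longrightarrow> h \<in> L1 \<Omega> \<Longrightarrow> P h"
    and \<delta>: "\<delta> > 0" "\<And>y. 0 < y \<Longrightarrow> y < \<delta> \<Longrightarrow> Q y"
    unfolding at_zero_L1_def eventually_inf_principal eventually_filtercomap
      eventually_at_right_field
    by blast
  then show "\<exists>\<delta>>0. \<forall>h\<in>L1 \<Omega>. 0 < norm_L1 \<Omega> h \<and> norm_L1 \<Omega> h < \<delta> \<longrightarrow> P h"
    by blast
next
  assume "\<exists>\<delta>>0. \<forall>h\<in>L1 \<Omega>. 0 < norm_L1 \<Omega> h \<and> norm_L1 \<Omega> h < \<delta> \<longrightarrow> P h"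
  then obtain \<delta> where \<delta>: "\<delta> > 0"
    and P: "\<And>h. h \<in> L1 \<Omega> \<Longrightarrow> 0 < norm_L1 \<Omega> h \<Longrightarrow> norm_L1 \<Omega> h < \<delta> \<Longrightarrow> P h"
    by blast
  have "eventually (\<lambda>y. 0 < y \<and> y < \<delta>) (at_right 0)"
    unfolding eventually_at_right_field using \<delta> by blast
  then show "eventually P (at_zero_L1 \<Omega>)"
    unfolding at_zero_L1_def eventually_inf_principal eventually_filtercomap
    using P by (intro exI[of _ "\<lambda>y. 0 < y \<and> y < \<delta>"]) simp
qed

definition frechet_subdiff_q10 ::
  "'a::euclidean_space set \<Rightarrow> ('a \<Rightarrow> real) \<Rightarrow> ('a \<Rightarrow> real) set set" where
  "frechet_subdiff_q10 \<Omega> u =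
     {\<eta> \<in> Linf \<Omega>.
        Liminf (at_zero_L1 \<Omega>)
          (\<lambda>h. ereal ((q10 \<Omega> (\<lambda>x. u x + h x) - q10 \<Omega> u - (\<integral>x. \<eta> x * h x \<partial>lebesgue_on \<Omega>))
                      / norm_L1 \<Omega> h)) \<ge> 0} // ae_rel \<Omega>"

end

theory Submission
  imports Defs
begin

text \<open>
  Perturbing \<open>u\<close> on a set \<open>A\<close> changes \<open>q10\<close> by at most the measure of \<open>A\<close>, however large the
  perturbation is. Since Lebesgue measure has no atoms, \<open>h = t * indicator A\<close> with \<open>t\<close> fixed and
  \<open>A\<close> small is admissible in the lower limit; letting \<open>t\<close> be large shows that a subgradient
  vanishes almost everywhere. If \<open>u\<close> is nonzero on a set of positive measure, then setting \<open>u\<close> to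
  zero on small subsets of \<open>{1/n \<le> \<bar>u\<bar> \<le> n}\<close> decreases \<open>q10\<close> at a linear rate, so not even
  \<open>0\<close> is a subgradient.
\<close>

section \<open>Small sets of positive measure and null sets\<close>

text \<open>Countably many balls of one small radius cover the space, so one of them meets
  \<open>A\<close> in a non-null set, whose measure is at most the volume of that ball.\<close>

lemma lebesgue_small_subset:
  fixes A :: "'a::euclidean_space set"
  assumes A: "A \<in> sets lebesgue" "\<not> negligible A" and "\<delta> > 0"
  obtains B where "B \<subseteq> A" "B \<in> lmeasurable" "0 < measure lebesgue B" "measure lebesgue B < \<delta>"
proof -
  define V where "V = unit_ball_vol (real DIM('a))"
  \<comment> \<open>The cap at 1 gives \<open>r ^ DIM('a) \<le> r\<close>, so the ball has volume at
    most \<open>V * r\<close>, hence at most \<open>\<delta> / 2\<close>.\<close>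
  define r where "r = min 1 (\<delta> / (2 * V))"
  have V: "V > 0" by (simp add: V_def)
  have r: "0 < r" "r \<le> 1" "V * r \<le> \<delta> / 2"
    using V \<open>\<delta> > 0\<close> by (auto simp: r_def min_def field_simps)
  have "r ^ DIM('a) \<le> r ^ 1"
    using r by (intro power_decreasing) (auto simp: DIM_positive Suc_leI)
  then have "V * r ^ DIM('a) \<le> V * r"
    using V by simp
  then have "V * r ^ DIM('a) \<le> \<delta> / 2"
    using r(3) by linarith
  then have ball: "measure lebesgue (ball x r) < \<delta>" for x :: 'a
    using content_ball[of r x] r(1) \<open>\<delta> > 0\<close> by (simp add: V_def)
  obtain D :: "'a set" where D: "countable D" "\<And>X. open X \<Longrightarrow> X \<noteq> {} \<Longrightarrow> \<exists>d\<in>D. d \<in> X"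
    using countable_dense_exists by blast
  have "A = (\<Union>d\<in>D. A \<inter> ball d r)"
  proof -
    have "\<exists>d\<in>D. x \<in> ball d r" for x
      using D(2)[of "ball x r"] r(1) by (auto simp: dist_commute)
    then show ?thesis by blast
  qed
  then have "\<exists>d\<in>D. \<not> negligible (A \<inter> ball d r)"
    using A(2) D(1) negligible_countable_Union[of "(\<lambda>d. A \<inter> ball d r) ` D"] by auto
  then obtain d where d: "\<not> negligible (A \<inter> ball d r)" by blast
  have lm: "A \<inter> ball d r \<in> lmeasurable"
    using A(1) by (metis fmeasurable_Int_fmeasurable inf_commute lmeasurable_ball)
  have "measure lebesgue (A \<inter> ball d r) \<le> measure lebesgue (ball d r)"
    using lm by (intro measure_mono_fmeasurable) (auto simp: fmeasurableD)
  then have "measure lebesgue (A \<inter> ball d r) < \<delta>" using ball[of d] by linarith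
  moreover have "0 < measure lebesgue (A \<inter> ball d r)"
    using d lm by (simp add: negligible_iff_measure zero_less_measure_iff)
  ultimately show ?thesis using that lm by blast
qed

text \<open>By completeness of Lebesgue measure, every subset of a null set is null, so the
  exceptional set can be tested directly for arbitrary \<open>P\<close>.\<close>

lemma AE_lebesgue_on_iff_negligible:
  assumes "\<Omega> \<in> sets lebesgue"
  shows "(AE x in lebesgue_on \<Omega>. P x) \<longleftrightarrow> negligible {x \<in> \<Omega>. \<not> P x}"
proof -
  have "(AE x in lebesgue_on \<Omega>. P x) \<longleftrightarrow> (AE x in lebesgue. x \<in> \<Omega> \<longrightarrow> P x)"
    using assms by (simp add: AE_restrict_space_iff)
  also have "\<dots> \<longleftrightarrow> (\<exists>N\<in>null_sets lebesgue. {x \<in> \<Omega>. \<not> P x} \<subseteq> N)"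
    by (simp add: eventually_ae_filter)
  also have "\<dots> \<longleftrightarrow> negligible {x \<in> \<Omega>. \<not> P x}"
    by (metis negligible_iff_null_sets negligible_subset order_refl)
  finally show ?thesis .
qed

section \<open>Subgradients on the level of representatives\<close>

abbreviation frechet_subgradient ::
  "'a::euclidean_space set \<Rightarrow> ('a \<Rightarrow> real) \<Rightarrow> ('a \<Rightarrow> real) \<Rightarrow> bool" where
  "frechet_subgradient \<Omega> u \<eta> \<equiv> 0 \<le> Liminf (at_zero_L1 \<Omega>)
          (\<lambda>h. ereal ((q10 \<Omega> (\<lambda>x. u x + h x) - q10 \<Omega> u - (\<integral>x. \<eta> x * h x \<partial>lebesgue_on \<Omega>))
                      / norm_L1 \<Omega> h))"

context
  fixes \<Omega> :: "'a::euclidean_space set"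
  assumes \<Omega>: "\<Omega> \<in> lmeasurable"
begin

lemma lebesgue_on_indicator:
  assumes "A \<subseteq> \<Omega>" "A \<in> lmeasurable"
  shows "A \<in> sets (lebesgue_on \<Omega>)"
    and "integrable (lebesgue_on \<Omega>) (indicator A :: _ \<Rightarrow> real)"
    and "(\<integral>x. indicator A x \<partial>lebesgue_on \<Omega>) = measure lebesgue A"
proof -
  interpret finite_measure "lebesgue_on \<Omega>" using \<Omega> by (rule finite_measure_lebesgue_on)
  show s: "A \<in> sets (lebesgue_on \<Omega>)"
    using assms \<Omega> by (simp add: sets_restrict_space_iff fmeasurableD)
  then show "integrable (lebesgue_on \<Omega>) (indicator A :: _ \<Rightarrow> real)"
    by (simp add: emeasure_finite less_top[symmetric])
  show "(\<integral>x. indicator A x \<partial>lebesgue_on \<Omega>) = measure lebesgue A"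
    using assms \<Omega> by (simp add: measure_restrict_space fmeasurableD Int_absorb2)
qed

lemma integrable_abs0:
  assumes "u \<in> borel_measurable (lebesgue_on \<Omega>)"
  shows "integrable (lebesgue_on \<Omega>) (\<lambda>x. abs0 (u x))"
proof -
  interpret finite_measure "lebesgue_on \<Omega>" using \<Omega> by (rule finite_measure_lebesgue_on)
  show ?thesis
    using assms by (intro integrable_const_bound[where B = 1]) (auto simp: abs0_def)
qed

text \<open>The epsilon-delta form of the lower limit, with the quotient cleared by multiplying with
  the positive norm.\<close>

lemma frechet_subgradient_bound:
  assumes "frechet_subgradient \<Omega> u \<eta>" and "\<epsilon> > 0"
  obtains \<delta> where "\<delta> > 0"
    "\<And>h. h \<in> L1 \<Omega> \<Longrightarrow> 0 < norm_L1 \<Omega> h \<Longrightarrow> norm_L1 \<Omega> h < \<delta> \<Longrightarrow>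
      - \<epsilon> * norm_L1 \<Omega> h \<le> q10 \<Omega> (\<lambda>x. u x + h x) - q10 \<Omega> u - (\<integral>x. \<eta> x * h x \<partial>lebesgue_on \<Omega>)"
proof -
  let ?Q = "\<lambda>h. (q10 \<Omega> (\<lambda>x. u x + h x) - q10 \<Omega> u - (\<integral>x. \<eta> x * h x \<partial>lebesgue_on \<Omega>))
                      / norm_L1 \<Omega> h"
  have "eventually (\<lambda>h. ereal (- \<epsilon>) < ereal (?Q h)) (at_zero_L1 \<Omega>)"
  proof -
    have "ereal (- \<epsilon>) < 0" using assms(2) by simp
    with assms(1) show ?thesis unfolding le_Liminf_iff by blast
  qed
  then obtain \<delta> where "\<delta> > 0"
    and Q: "\<And>h. h \<in> L1 \<Omega> \<Longrightarrow> 0 < norm_L1 \<Omega> h \<Longrightarrow> norm_L1 \<Omega> h < \<delta> \<Longrightarrow> - \<epsilon> < ?Q h"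
    unfolding eventually_at_zero_L1 by auto
  show ?thesis
  proof (rule that[OF \<open>\<delta> > 0\<close>])
    fix h assume "h \<in> L1 \<Omega>" "0 < norm_L1 \<Omega> h" "norm_L1 \<Omega> h < \<delta>"
    with Q[of h] show "- \<epsilon> * norm_L1 \<Omega> h \<le> q10 \<Omega> (\<lambda>x. u x + h x) - q10 \<Omega> u
        - (\<integral>x. \<eta> x * h x \<partial>lebesgue_on \<Omega>)"
      by (simp add: pos_less_divide_eq)
  qed
qed

text \<open>Otherwise \<open>s * \<eta>\<close> exceeds \<open>c\<close> on a small non-null
  \<open>B\<close>. A perturbation of height \<open>2 / c\<close> on \<open>B\<close> raises
  \<open>q10\<close> by at most the measure of \<open>B\<close>, but the linear term is at least
  twice that measure. The sign \<open>s\<close> serves to bound \<open>\<eta>\<close> from above and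
  from below.\<close>

lemma frechet_subgradient_sign_le:
  assumes u: "u \<in> L1 \<Omega>" and \<eta>: "\<eta> \<in> Linf \<Omega>"
    and lim: "frechet_subgradient \<Omega> u \<eta>"
    and s: "\<bar>s\<bar> = 1" and c: "c > 0"
  shows "AE x in lebesgue_on \<Omega>. s * \<eta> x \<le> c"
proof (rule ccontr)
  let ?M = "lebesgue_on \<Omega>"
  assume "\<not> (AE x in ?M. s * \<eta> x \<le> c)"
  then have A: "\<not> negligible {x \<in> \<Omega>. \<not> s * \<eta> x \<le> c}"
    using \<Omega> by (simp add: AE_lebesgue_on_iff_negligible fmeasurableD)
  have [measurable]: "\<eta> \<in> borel_measurable ?M" "u \<in> borel_measurable ?M"
    using \<eta> u by (auto simp: Linf_def L1_def)
  have "{x \<in> space ?M. \<not> s * \<eta> x \<le> c} \<in> sets ?M" by measurable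
  then have A': "{x \<in> \<Omega>. \<not> s * \<eta> x \<le> c} \<in> sets lebesgue"
    using \<Omega> by (simp add: sets_restrict_space_iff fmeasurableD)
  obtain \<delta> where \<delta>: "\<delta> > 0"
    "\<And>h. h \<in> L1 \<Omega> \<Longrightarrow> 0 < norm_L1 \<Omega> h \<Longrightarrow> norm_L1 \<Omega> h < \<delta> \<Longrightarrow>
      - (c / 4) * norm_L1 \<Omega> h \<le> q10 \<Omega> (\<lambda>x. u x + h x) - q10 \<Omega> u - (\<integral>x. \<eta> x * h x \<partial>?M)"
    using frechet_subgradient_bound[OF lim, of "c / 4"] c by auto
  \<comment> \<open>The bound \<open>\<delta> * c / 2\<close> is what makes the norm of
    \<open>h\<close>, equal to \<open>2 / c\<close> times the measure of \<open>B\<close>, smaller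
    than \<open>\<delta>\<close>.\<close>
  obtain B where B: "B \<subseteq> {x \<in> \<Omega>. \<not> s * \<eta> x \<le> c}" "B \<in> lmeasurable"
      "0 < measure lebesgue B" "measure lebesgue B < \<delta> * c / 2"
    using lebesgue_small_subset[OF A' A, of "\<delta> * c / 2"] \<delta>(1) c by auto
  note ind = lebesgue_on_indicator[OF _ B(2)]
  have B\<Omega>: "B \<subseteq> \<Omega>" using B(1) by auto
  note [measurable] = ind(1)[OF B\<Omega>]
  note [simp] = ind(2)[OF B\<Omega>]
  define h where "h x = 2 / c * s * indicator B x" for x
  have h: "h \<in> L1 \<Omega>" by (simp add: L1_def h_def[abs_def])
  have norm: "norm_L1 \<Omega> h = 2 / c * measure lebesgue B"
    using c s ind(3)[OF B\<Omega>] by (simp add: norm_L1_def h_def abs_mult)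
  have "q10 \<Omega> (\<lambda>x. u x + h x) \<le> (\<integral>x. abs0 (u x) + indicator B x \<partial>?M)"
    unfolding q10_def
  proof (intro integral_mono integrable_abs0 Bochner_Integration.integrable_add)
    show "abs0 (u x + h x) \<le> abs0 (u x) + indicator B x" for x
      by (auto simp: h_def abs0_def indicator_def)
  qed (simp_all add: h_def[abs_def])
  also have "\<dots> = q10 \<Omega> u + measure lebesgue B"
    using ind(3)[OF B\<Omega>] by (simp add: q10_def integrable_abs0)
  finally have q: "q10 \<Omega> (\<lambda>x. u x + h x) \<le> q10 \<Omega> u + measure lebesgue B" .
  obtain C where C: "AE x in ?M. \<bar>\<eta> x\<bar> \<le> C" using \<eta> by (auto simp: Linf_def)
  have int: "integrable ?M (\<lambda>x. \<eta> x * h x)"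
  proof (rule Bochner_Integration.integrable_bound[of ?M "\<lambda>x. C * \<bar>h x\<bar>"])
    show "integrable ?M (\<lambda>x. C * \<bar>h x\<bar>)" using h by (simp add: L1_def)
    show "(\<lambda>x. \<eta> x * h x) \<in> borel_measurable ?M" unfolding h_def by measurable
    show "AE x in ?M. norm (\<eta> x * h x) \<le> norm (C * \<bar>h x\<bar>)"
      using C by eventually_elim (auto simp: abs_mult intro!: mult_right_mono)
  qed
  have "2 * measure lebesgue B = (\<integral>x. 2 * indicator B x \<partial>?M)"
    using ind(3)[OF B\<Omega>] by simp
  also have "\<dots> \<le> (\<integral>x. \<eta> x * h x \<partial>?M)"
  proof (intro integral_mono int)
    show "2 * indicator B x \<le> \<eta> x * h x" for x
      using B(1) c by (auto simp: h_def indicator_def field_simps)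
  qed simp
  finally have "2 * measure lebesgue B \<le> (\<integral>x. \<eta> x * h x \<partial>?M)" .
  moreover have "norm_L1 \<Omega> h > 0" "norm_L1 \<Omega> h < \<delta>"
    unfolding norm using B(3,4) c by (auto simp: field_simps)
  then have "- (c / 4) * norm_L1 \<Omega> h \<le> q10 \<Omega> (\<lambda>x. u x + h x) - q10 \<Omega> u - (\<integral>x. \<eta> x * h x \<partial>?M)"
    using \<delta>(2)[OF h] by blast
  \<comment> \<open>With m the measure of \<open>B\<close>, the numerator is at most m - 2m = -m,
    below the required -m/2.\<close>
  moreover have "- (c / 4) * norm_L1 \<Omega> h = - measure lebesgue B / 2"
    using norm c by simp
  ultimately show False using q B(3) by linarith
qed

text \<open>Both signs and the bounds \<open>c = 1 / Suc n\<close> give countably many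
  almost-everywhere statements, which hold simultaneously off one null set.\<close>

lemma frechet_subgradient_eq_0:
  assumes "u \<in> L1 \<Omega>" "\<eta> \<in> Linf \<Omega>"
    "frechet_subgradient \<Omega> u \<eta>"
  shows "AE x in lebesgue_on \<Omega>. \<eta> x = 0"
proof -
  have "AE x in lebesgue_on \<Omega>. \<forall>n::nat. \<bar>\<eta> x\<bar> \<le> 1 / Suc n"
    unfolding AE_all_countable
  proof
    fix n :: nat
    have "AE x in lebesgue_on \<Omega>. 1 * \<eta> x \<le> 1 / Suc n" "AE x in lebesgue_on \<Omega>. -1 * \<eta> x \<le> 1 / Suc n"
      by (rule frechet_subgradient_sign_le[OF assms]; simp)+
    then show "AE x in lebesgue_on \<Omega>. \<bar>\<eta> x\<bar> \<le> 1 / Suc n"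
      by eventually_elim auto
  qed
  then show ?thesis
  proof eventually_elim
    case (elim x)
    then show ?case
      using nat_approx_posE[of "\<bar>\<eta> x\<bar>"] by (metis abs_le_zero_iff leD linorder_not_le of_nat_Suc)
  qed
qed

section \<open>Nonzero base points\<close>

lemma frechet_subgradient_imp_base_point_eq_0:
  assumes u: "u \<in> L1 \<Omega>" and \<eta>: "\<eta> \<in> Linf \<Omega>"
    and lim: "frechet_subgradient \<Omega> u \<eta>"
  shows "AE x in lebesgue_on \<Omega>. u x = 0"
proof -
  let ?M = "lebesgue_on \<Omega>"
  have [measurable]: "u \<in> borel_measurable ?M" using u by (auto simp: L1_def)
  \<comment> \<open>The lower bound on \<open>\<bar>u x\<bar>\<close> makes erasing \<open>u\<close>
    on \<open>B\<close> lower \<open>q10\<close> by the full measure of \<open>B\<close>; the upper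
    bound keeps the cost in norm at most \<open>N\<close> times that measure. The quotient is then
    at most \<open>- 1 / N\<close>, which contradicts the bound with
    \<open>1 / (2 * N)\<close>.\<close>
  have ae: "AE x in ?M. \<not> (1 / N \<le> \<bar>u x\<bar> \<and> \<bar>u x\<bar> \<le> N)" if N: "N > 0" for N :: real
  proof (rule ccontr)
    let ?A = "{x \<in> \<Omega>. 1 / N \<le> \<bar>u x\<bar> \<and> \<bar>u x\<bar> \<le> N}"
    assume "\<not> ?thesis"
    then have A: "\<not> negligible ?A"
      using \<Omega> by (simp add: AE_lebesgue_on_iff_negligible fmeasurableD)
    have "{x \<in> space ?M. 1 / N \<le> \<bar>u x\<bar> \<and> \<bar>u x\<bar> \<le> N} \<in> sets ?M" by measurable
    then have A': "?A \<in> sets lebesgue"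
      using \<Omega> by (simp add: sets_restrict_space_iff fmeasurableD)
    obtain \<delta> where \<delta>: "\<delta> > 0"
      "\<And>h. h \<in> L1 \<Omega> \<Longrightarrow> 0 < norm_L1 \<Omega> h \<Longrightarrow> norm_L1 \<Omega> h < \<delta> \<Longrightarrow>
        - (1 / (2 * N)) * norm_L1 \<Omega> h
          \<le> q10 \<Omega> (\<lambda>x. u x + h x) - q10 \<Omega> u - (\<integral>x. \<eta> x * h x \<partial>?M)"
      using frechet_subgradient_bound[OF lim, of "1 / (2 * N)"] N by auto
    obtain B where B: "B \<subseteq> ?A" "B \<in> lmeasurable"
        "0 < measure lebesgue B" "measure lebesgue B < \<delta> / N"
      using lebesgue_small_subset[OF A' A, of "\<delta> / N"] \<delta>(1) N by auto
    note ind = lebesgue_on_indicator[OF _ B(2)]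
    have B\<Omega>: "B \<subseteq> \<Omega>" using B(1) by auto
    note [measurable] = ind(1)[OF B\<Omega>]
    note [simp] = ind(2)[OF B\<Omega>]
    have uB: "1 / N \<le> \<bar>u x\<bar>" "\<bar>u x\<bar> \<le> N" "u x \<noteq> 0" if "x \<in> B" for x
      using B(1) N that by (auto simp: field_simps)
    \<comment> \<open>Then \<open>u + h\<close> vanishes on \<open>B\<close> and agrees with
      \<open>u\<close> elsewhere.\<close>
    define h where "h x = - (indicator B x * u x)" for x
    have h: "h \<in> L1 \<Omega>"
      using u integrable_mult_indicator[OF ind(1)[OF B\<Omega>], of u]
      by (simp add: L1_def h_def[abs_def])
    have "norm_L1 \<Omega> h \<le> (\<integral>x. N * indicator B x \<partial>?M)"
      unfolding norm_L1_def
    proof (intro integral_mono)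
      show "\<bar>h x\<bar> \<le> N * indicator B x" for x
        using uB N by (auto simp: h_def indicator_def)
    qed (use h in \<open>simp_all add: L1_def\<close>)
    then have n1: "norm_L1 \<Omega> h \<le> N * measure lebesgue B"
      using ind(3)[OF B\<Omega>] by simp
    have "(\<integral>x. 1 / N * indicator B x \<partial>?M) \<le> norm_L1 \<Omega> h"
      unfolding norm_L1_def
    proof (intro integral_mono)
      show "1 / N * indicator B x \<le> \<bar>h x\<bar>" for x
        using uB N by (auto simp: h_def indicator_def)
    qed (use h in \<open>simp_all add: L1_def\<close>)
    then have n2: "1 / N * measure lebesgue B \<le> norm_L1 \<Omega> h"
      using ind(3)[OF B\<Omega>] by simp
    have n3: "0 < norm_L1 \<Omega> h"
      using n2 B(3) N by (smt (verit) divide_pos_pos mult_pos_pos)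
    have n4: "norm_L1 \<Omega> h < \<delta>"
      using n1 B(4) N by (simp add: field_simps)
    have "q10 \<Omega> (\<lambda>x. u x + h x) = (\<integral>x. abs0 (u x) - indicator B x \<partial>?M)"
      unfolding q10_def
      by (intro Bochner_Integration.integral_cong) (use uB in \<open>auto simp: h_def abs0_def indicator_def\<close>)
    also have "\<dots> = q10 \<Omega> u - measure lebesgue B"
      using ind(3)[OF B\<Omega>] by (simp add: q10_def integrable_abs0)
    finally have q: "q10 \<Omega> (\<lambda>x. u x + h x) = q10 \<Omega> u - measure lebesgue B" .
    \<comment> \<open>The linear term drops out because a subgradient is already known to vanish
      almost everywhere.\<close>
    have "(\<integral>x. \<eta> x * h x \<partial>?M) = 0"
      by (rule integral_eq_zero_AE)
        (use frechet_subgradient_eq_0[OF assms] in eventually_elim, simp)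
    then have "- (1 / (2 * N)) * norm_L1 \<Omega> h \<le> - measure lebesgue B"
      using \<delta>(2)[OF h n3 n4] q by simp
    moreover have "1 / (2 * N) * norm_L1 \<Omega> h \<le> measure lebesgue B / 2"
      using n1 N by (simp add: field_simps)
    ultimately show False using B(3) by simp
  qed
  \<comment> \<open>\<open>Suc n\<close> is a positive level, as \<open>ae\<close> requires, and
    these countably many null sets cover all points where \<open>u\<close> is nonzero.\<close>
  have "AE x in ?M. \<forall>n::nat. \<not> (1 / Suc n \<le> \<bar>u x\<bar> \<and> \<bar>u x\<bar> \<le> Suc n)"
    unfolding AE_all_countable using ae by simp
  then show ?thesis
  proof eventually_elim
    case (elim x)
    show ?case
    proof (rule ccontr)
      assume nz: "u x \<noteq> 0"
      obtain n :: nat where n: "max \<bar>u x\<bar> (1 / \<bar>u x\<bar>) \<le> n" using real_arch_simple by blast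
      then have "1 / Suc n \<le> \<bar>u x\<bar>" "\<bar>u x\<bar> \<le> Suc n"
        using nz by (auto simp: field_simps)
      then show False using elim by blast
    qed
  qed
qed

section \<open>The zero base point and passage to classes\<close>

text \<open>Here the numerator is just \<open>q10\<close> of the perturbed function, so the quotient
  is nonnegative for every \<open>h\<close>, not only in the limit.\<close>

lemma zero_frechet_subgradient:
  assumes "AE x in lebesgue_on \<Omega>. u x = 0"
  shows "frechet_subgradient \<Omega> u (\<lambda>x. 0)"
proof -
  have "q10 \<Omega> u = 0"
    unfolding q10_def by (rule integral_eq_zero_AE) (use assms in eventually_elim, simp add: abs0_def)
  moreover have "0 \<le> q10 \<Omega> v" for v
    unfolding q10_def by (rule Bochner_Integration.integral_nonneg) (simp add: abs0_def)
  moreover have "0 \<le> norm_L1 \<Omega> v" for v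
    unfolding norm_L1_def by (rule Bochner_Integration.integral_nonneg) simp
  ultimately show ?thesis
    by (intro Liminf_bounded always_eventually) simp
qed

end

theorem theorem3p3:
  fixes \<Omega> :: "(real ^ 'd) set" and u :: "real ^ 'd \<Rightarrow> real"
  assumes "\<Omega> \<in> lmeasurable" and "measure lebesgue \<Omega> > 0"
    and "u \<in> L1 \<Omega>"
  shows "frechet_subdiff_q10 \<Omega> u =
    (if (AE x in lebesgue_on \<Omega>. u x = 0) then {ae_rel \<Omega> `` {\<lambda>x. 0}} else {})"
proof -
  define S where "S = {\<eta> \<in> Linf \<Omega>. frechet_subgradient \<Omega> u \<eta>}"
  have F: "frechet_subdiff_q10 \<Omega> u = S // ae_rel \<Omega>"
    by (simp add: frechet_subdiff_q10_def S_def)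
  show ?thesis
  proof (cases "AE x in lebesgue_on \<Omega>. u x = 0")
    case True
    have "(\<lambda>x. 0) \<in> S"
      using zero_frechet_subgradient[OF assms(1) True] by (auto simp: S_def Linf_def)
    \<comment> \<open>All representatives in \<open>S\<close> vanish almost everywhere, so they form
      a single class.\<close>
    moreover have "ae_rel \<Omega> `` {\<eta>} = ae_rel \<Omega> `` {\<lambda>x. 0}" if "\<eta> \<in> S" for \<eta>
    proof (rule equiv_class_eq[OF equiv_ae_rel])
      show "(\<eta>, \<lambda>x. 0) \<in> ae_rel \<Omega>"
        using that frechet_subgradient_eq_0[OF assms(1,3)]
        by (simp add: S_def ae_rel_def Linf_def)
    qed
    ultimately have "S // ae_rel \<Omega> = {ae_rel \<Omega> `` {\<lambda>x. 0}}"
      unfolding quotient_def by blast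
    with True F show ?thesis by simp
  next
    case False
    then have "S = {}"
      using frechet_subgradient_imp_base_point_eq_0[OF assms(1,3)] by (auto simp: S_def)
    with False F show ?thesis by simp
  qed
qed

end
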